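(* If $A\subseteq\omega$ is a weakly 1-random real, then $A$ is density-1-bounding in the generic degrees.
   Context: A real is a subset of $\omega$, identified with its characteristic function $\omega\to\{0,1\}$. A real $X$ is density-1 if $\lim_{n\to\infty}|X\cap n|/n=1$, where $n=\{0,\dots,n-1\}$. A real is weakly 1-random if it belongs to no $\Pi^0_1$ class of measure $0$ in $2^\omega$. A (time-dependent) partial oracle $(A)$ for a real $A$ is a set of triples $\langle n,x,l\rangle$ with $n,l\in\omega$, $x\in\{0,1\}$, such that $\langle n,x,l\rangle\in(A)$ implies $A(n)=x$, and for every $n,x$ there is at most one $l$ with $\langle n,x,l\rangle\in(A)$. Its domain is the set of $n$ for which some $\langle n,x,l\rangle\in(A)$ exists. A Turing functional $\phi$ uses $(A)$ as an ordinary oracle for this set of triples. A generic oracle for $A$ is a partial oracle for $A$ with density-1 domain. A generic computation of $B$ is a partial function $\psi$ computed by some machine (possibly with an oracle), with density-1 domain, such that $\psi(n)=B(n)$ whenever $\psi(n)\downarrow$. $B$ is generically computable if it has a generic computation without oracle. $B\leq_{\mathrm{g}}A$ if there is a single Turing functional $\phi$ such that for every generic oracle $(A)$ for $A$, $\phi^{(A)}$ is a generic computation of $B$. The generic degrees are the equivalence classes induced by $\leq_{\mathrm{g}}$; the zero degree consists of the generically computable reals. A real $A$ is density-1-bounding (in the generic degrees) if there is a density-1 real $B$ that is not generically computable with $B\leq_{\mathrm{g}}A$. *)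

theory Defs
  imports "HOL-Probability.Probability" "HOL-Library.Nat_Bijection"
begin

section \<open>Oracle computations\<close>

text \<open>
  Turing functionals are rendered as partial recursive functionals, i.e. the mu-recursive
  functions with one additional initial function, the characteristic function of the oracle.
  Programs carry no arities: a program applied to an argument list of unsuitable length diverges.
\<close>

datatype recf =
    Zero
  | Succ
  | Proj nat
  | Query
  | Comp recf "recf list"
  | PrimRec recf recf
  | Mu recf

text \<open>
  The result is \<open>None\<close> when the computation diverges. Composition is strict in all its arguments;
  the first argument of a \<open>PrimRec\<close> program is the recursion variable; \<open>Mu p\<close> returns the least
  zero of \<open>p\<close>, provided that \<open>p\<close> converges on all smaller values.
\<close>

primrec run :: "nat set \<Rightarrow> recf \<Rightarrow> nat list \<Rightarrow> nat option" where
  "run Z Zero xs = Some 0"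
| "run Z Succ xs = (case xs of [x] \<Rightarrow> Some (Suc x) | _ \<Rightarrow> None)"
| "run Z (Proj i) xs = (if i < length xs then Some (xs ! i) else None)"
| "run Z Query xs = (case xs of [x] \<Rightarrow> Some (of_bool (x \<in> Z)) | _ \<Rightarrow> None)"
| "run Z (Comp p qs) xs =
     (let ys = map (\<lambda>q. run Z q xs) qs
      in if None \<in> set ys then None else run Z p (map the ys))"
| "run Z (PrimRec p q) xs =
     (case xs of
        [] \<Rightarrow> None
      | n # ys \<Rightarrow>
          rec_nat (run Z p ys) (\<lambda>m r. Option.bind r (\<lambda>v. run Z q (m # v # ys))) n)"
| "run Z (Mu p) xs =
     (if \<exists>y. run Z p (y # xs) = Some 0 \<and> (\<forall>i<y. \<exists>v. run Z p (i # xs) = Some (Suc v))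
      then Some (LEAST y. run Z p (y # xs) = Some 0)
      else None)"

text \<open>A computation without oracle is a computation with the empty oracle.\<close>

abbreviation run0 :: "recf \<Rightarrow> nat list \<Rightarrow> nat option" where
  "run0 \<equiv> run {}"


section \<open>Weak 1-randomness\<close>

definition string_code :: "bool list \<Rightarrow> nat" where
  "string_code \<sigma> = list_encode (map of_bool \<sigma>)"

definition ce_strings :: "bool list set \<Rightarrow> bool" where
  "ce_strings W \<longleftrightarrow> (\<exists>p. W = {\<sigma>. run0 p [string_code \<sigma>] \<noteq> None})"

definition initial_segment :: "bool list \<Rightarrow> nat set \<Rightarrow> bool" where
  "initial_segment \<sigma> X \<longleftrightarrow> (\<forall>i<length \<sigma>. \<sigma> ! i \<longleftrightarrow> i \<in> X)"

text \<open>The complement of an effectively open set, a c.e. union of basic open cylinders.\<close>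

definition Pi01_class :: "nat set set \<Rightarrow> bool" where
  "Pi01_class C \<longleftrightarrow>
     (\<exists>W. ce_strings W \<and> C = {X. \<not> (\<exists>\<sigma>\<in>W. initial_segment \<sigma> X)})"

definition cantor_measure :: "(nat \<Rightarrow> bool) measure" where
  "cantor_measure = PiM UNIV (\<lambda>_. measure_pmf (bernoulli_pmf (1/2)))"

text \<open>
  The bijection \<open>Collect\<close> takes a characteristic function to the corresponding subset of \<open>nat\<close>.
\<close>

definition measure_zero :: "nat set set \<Rightarrow> bool" where
  "measure_zero C \<longleftrightarrow> {x. Collect x \<in> C} \<in> null_sets cantor_measure"

definition weakly_1_random :: "nat set \<Rightarrow> bool" where
  "weakly_1_random A \<longleftrightarrow> (\<forall>C. Pi01_class C \<and> measure_zero C \<longrightarrow> A \<notin> C)"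


section \<open>Generic reducibility\<close>

definition density_1 :: "nat set \<Rightarrow> bool" where
  "density_1 X \<longleftrightarrow> (\<lambda>n. real (card (X \<inter> {..<n})) / real n) \<longlonglongrightarrow> 1"

definition partial_oracle :: "nat set \<Rightarrow> (nat \<times> bool \<times> nat) set \<Rightarrow> bool" where
  "partial_oracle A P \<longleftrightarrow>
     (\<forall>n x l. (n, x, l) \<in> P \<longrightarrow> (n \<in> A) = x) \<and>
     (\<forall>n x l l'. (n, x, l) \<in> P \<and> (n, x, l') \<in> P \<longrightarrow> l = l')"

definition oracle_domain :: "(nat \<times> bool \<times> nat) set \<Rightarrow> nat set" where
  "oracle_domain P = {n. \<exists>x l. (n, x, l) \<in> P}"

definition generic_oracle :: "nat set \<Rightarrow> (nat \<times> bool \<times> nat) set \<Rightarrow> bool" where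
  "generic_oracle A P \<longleftrightarrow> partial_oracle A P \<and> density_1 (oracle_domain P)"

definition triple_code :: "nat \<times> bool \<times> nat \<Rightarrow> nat" where
  "triple_code = (\<lambda>(n, x, l). prod_encode (n, prod_encode (of_bool x, l)))"

text \<open>The program \<open>p\<close> with oracle \<open>Z\<close> is a generic computation of \<open>B\<close>.\<close>

definition generic_computation :: "nat set \<Rightarrow> recf \<Rightarrow> nat set \<Rightarrow> bool" where
  "generic_computation Z p B \<longleftrightarrow>
     density_1 {n. run Z p [n] \<noteq> None} \<and>
     (\<forall>n v. run Z p [n] = Some v \<longrightarrow> v = of_bool (n \<in> B))"

definition generically_computable :: "nat set \<Rightarrow> bool" where
  "generically_computable B \<longleftrightarrow> (\<exists>p. generic_computation {} p B)"

definition generically_reducible :: "nat set \<Rightarrow> nat set \<Rightarrow> bool" (infix "\<le>\<^sub>g" 50) where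
  "B \<le>\<^sub>g A \<longleftrightarrow> (\<exists>p. \<forall>P. generic_oracle A P \<longrightarrow> generic_computation (triple_code ` P) p B)"

definition density_1_bounding :: "nat set \<Rightarrow> bool" where
  "density_1_bounding A \<longleftrightarrow> (\<exists>B. density_1 B \<and> \<not> generically_computable B \<and> B \<le>\<^sub>g A)"

end

theory Submission imports Defs begin

text \<open>
  Number the binary strings so that the strings of each length form a block, and let \<open>B\<close> be the set
  of strings that are not initial segments of \<open>A\<close>. It misses one string of each length. A string is
  known to be in \<open>B\<close> as soon as it disagrees with one value of a partial oracle for \<open>A\<close>; if the
  domain of the oracle is infinite, then all but a fraction \<open>1 / 2 ^ r\<close> of the long strings disagree
  with its first \<open>r\<close> values, so this search halts with density 1. On the other hand, a generic
  computation of \<open>B\<close> without oracle enumerates a subset \<open>W\<close> of \<open>B\<close> of density 1. The reals without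
  initial segment in \<open>W\<close> form an effectively closed class of measure 0, which contains \<open>A\<close>.
\<close>

section \<open>Numbering the binary strings\<close>

text \<open>
  The binary digits of \<open>num \<sigma>\<close> are a leading 1, then \<open>\<sigma>\<close> with its first entry in the lowest
  position. No string has number 0.
\<close>

primrec num :: "bool list \<Rightarrow> nat" where
  "num [] = 1"
| "num (b # \<sigma>) = of_bool b + 2 * num \<sigma>"

lemma num_pos [simp]: "0 < num \<sigma>"
  by (induction \<sigma>) auto

lemma num_neq_0 [simp]: "num \<sigma> \<noteq> 0"
  by (simp add: neq0_conv)

lemma inj_num: "inj num"
proof (rule injI)
  show "num \<sigma> = num \<tau> \<Longrightarrow> \<sigma> = \<tau>" for \<sigma> \<tau>
  proof (induction \<sigma> arbitrary: \<tau>)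
    case Nil
    then show ?case
      by (cases \<tau>) (auto simp: of_bool_def split: if_splits)
  next
    case (Cons b \<sigma>)
    show ?case
    proof (cases \<tau>)
      case Nil
      then show ?thesis
        using Cons.prems by (auto simp: of_bool_def split: if_splits)
    next
      case [simp]: (Cons c \<tau>')
      have "b = c \<and> num \<sigma> = num \<tau>'"
        using Cons.prems by (cases b; cases c; simp; presburger)
      then show ?thesis
        using Cons.IH by simp
    qed
  qed
qed

lemma num_eq_iff [simp]: "num \<sigma> = num \<tau> \<longleftrightarrow> \<sigma> = \<tau>"
  using inj_num by (auto dest: injD)

lemma num_bounds: "2 ^ length \<sigma> \<le> num \<sigma> \<and> num \<sigma> < 2 ^ Suc (length \<sigma>)"
  by (induction \<sigma>) auto

lemma length_less_num: "length \<sigma> < num \<sigma>"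
  using num_bounds[of \<sigma>] less_exp[of "length \<sigma>"] by linarith

lemma ex_num: "0 < m \<Longrightarrow> \<exists>\<sigma>. num \<sigma> = m"
proof (induction m rule: less_induct)
  case (less m)
  show ?case
  proof (cases "m = 1")
    case True
    then show ?thesis by (metis num.simps(1))
  next
    case False
    then obtain \<sigma> where "num \<sigma> = m div 2"
      using less.IH[of "m div 2"] less.prems by auto
    then have "num (odd m # \<sigma>) = m"
      by simp
    then show ?thesis ..
  qed
qed

text \<open>Each halving removes the first entry. Programs can thus read entry \<open>i\<close> as
  the parity of a quotient, and recognize \<open>i < length \<sigma>\<close> by the quotient by
  \<open>2 ^ Suc i\<close> being nonzero.\<close>

lemma num_div_pow: "i \<le> length \<sigma> \<Longrightarrow> num \<sigma> div 2 ^ i = num (drop i \<sigma>)"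
proof (induction \<sigma> arbitrary: i)
  case (Cons b \<sigma>)
  then show ?case
    by (cases i) (simp_all add: div_mult2_eq)
qed simp

lemma num_div_pow_eq_0: "length \<sigma> < i \<Longrightarrow> num \<sigma> div 2 ^ i = 0"
  using num_bounds[of \<sigma>] power_increasing[of "Suc (length \<sigma>)" i "2::nat"]
  by (metis Suc_leI div_less less_le_trans one_le_numeral)

lemma odd_num: "\<sigma> \<noteq> [] \<Longrightarrow> odd (num \<sigma>) \<longleftrightarrow> hd \<sigma>"
  by (cases \<sigma>) auto

lemma odd_num_div_pow: "i < length \<sigma> \<Longrightarrow> odd (num \<sigma> div 2 ^ i) \<longleftrightarrow> \<sigma> ! i"
  by (simp add: num_div_pow odd_num hd_drop_conv_nth)

lemma finite_strings [simp]: "finite {\<sigma> :: bool list. length \<sigma> = k \<and> P \<sigma>}"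
  by (rule finite_subset[OF _ finite_lists_length_eq[of "UNIV :: bool set" k]]) auto

lemma num_image_level:
  "num ` {\<sigma>. length \<sigma> = k \<and> P (num \<sigma>)} = {m \<in> {2 ^ k..<2 ^ Suc k}. P m}" (is "?L = ?R")
proof
  show "?L \<subseteq> ?R"
    using num_bounds by fastforce
  show "?R \<subseteq> ?L"
  proof
    fix m assume m: "m \<in> ?R"
    then have "0 < m"
      by (cases "m = 0") simp_all
    then obtain \<sigma> where \<sigma>: "num \<sigma> = m"
      using ex_num by blast
    have "2 ^ k \<le> num \<sigma>" "num \<sigma> < 2 ^ Suc k"
      using m \<sigma> by simp_all
    then have "2 ^ length \<sigma> < (2::nat) ^ Suc k" "(2::nat) ^ k < 2 ^ Suc (length \<sigma>)"
      using num_bounds[of \<sigma>] by linarith+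
    then have "length \<sigma> < Suc k" "k < Suc (length \<sigma>)"
      using power_less_imp_less_exp[of "2::nat" "length \<sigma>" "Suc k"]
        power_less_imp_less_exp[of "2::nat" k "Suc (length \<sigma>)"]
      by (simp_all del: power_Suc)
    then have "length \<sigma> = k"
      by simp
    then show "m \<in> ?L"
      using m \<sigma> by auto
  qed
qed

section \<open>Density along the lengths of strings\<close>

text \<open>Divided by \<open>2 ^ k\<close>, this is the fraction of the strings of length
  \<open>k\<close> with number outside \<open>X\<close>. The two implications below make density 1
  equivalent to its convergence to 0.\<close>

abbreviation missing :: "nat set \<Rightarrow> nat \<Rightarrow> nat" where
  "missing X k \<equiv> card {\<sigma>. length \<sigma> = k \<and> num \<sigma> \<notin> X}"

lemma missing_eq: "missing X k = card ({2 ^ k..<2 ^ Suc k} - X)"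
proof -
  have "missing X k = card (num ` {\<sigma>. length \<sigma> = k \<and> num \<sigma> \<notin> X})"
    by (rule card_image[symmetric]) (rule inj_on_subset[OF inj_num subset_UNIV])
  also have "num ` {\<sigma>. length \<sigma> = k \<and> num \<sigma> \<notin> X} = {2 ^ k..<2 ^ Suc k} - X"
    using num_image_level[of k "\<lambda>m. m \<notin> X"] by auto
  finally show ?thesis .
qed

lemma density_1_iff_complement:
  "density_1 X \<longleftrightarrow> (\<lambda>n. real (card ({..<n} - X)) / real n) \<longlonglongrightarrow> 0"
proof -
  have "card (X \<inter> {..<n}) + card ({..<n} - X) = n" for n
    using card_Int_Diff[of "{..<n}" X] by (simp add: Int_commute)
  then have "real (card (X \<inter> {..<n})) + real (card ({..<n} - X)) = real n" for n
    unfolding of_nat_add[symmetric] by (simp only:)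
  then have "real (card (X \<inter> {..<n})) = real n - real (card ({..<n} - X))" for n
    by (simp only: eq_diff_eq)
  \<comment> \<open>At \<open>n = 0\<close> both quotients are 0 by convention, so the identity
    starts at 1.\<close>
  then have eq: "\<forall>\<^sub>F n in sequentially.
      real (card (X \<inter> {..<n})) / real n = 1 - real (card ({..<n} - X)) / real n"
    by (intro eventually_sequentiallyI[of 1]) (simp add: field_simps)
  have "density_1 X \<longleftrightarrow> (\<lambda>n. 1 - real (card ({..<n} - X)) / real n) \<longlonglongrightarrow> 1"
    unfolding density_1_def by (rule tendsto_cong[OF eq])
  also have "\<dots> \<longleftrightarrow> (\<lambda>n. real (card ({..<n} - X)) / real n) \<longlonglongrightarrow> 0"
  proof
    assume "(\<lambda>n. 1 - real (card ({..<n} - X)) / real n) \<longlonglongrightarrow> 1"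
    from tendsto_diff[OF tendsto_const[of 1] this]
    show "(\<lambda>n. real (card ({..<n} - X)) / real n) \<longlonglongrightarrow> 0" by simp
  next
    assume "(\<lambda>n. real (card ({..<n} - X)) / real n) \<longlonglongrightarrow> 0"
    from tendsto_diff[OF tendsto_const[of 1] this]
    show "(\<lambda>n. 1 - real (card ({..<n} - X)) / real n) \<longlonglongrightarrow> 1" by simp
  qed
  finally show ?thesis .
qed

text \<open>The block for length \<open>k\<close> is the upper half of the interval below
  \<open>2 ^ Suc k\<close>; hence the factor 2 in the bound.\<close>

lemma density_1_imp_missing:
  assumes "density_1 X"
  shows "(\<lambda>k. real (missing X k) / 2 ^ k) \<longlonglongrightarrow> 0"
proof -
  have "filterlim (\<lambda>k. 2 ^ Suc k :: nat) at_top sequentially"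
    by (intro filterlim_subseq strict_monoI) simp
  from filterlim_compose[OF assms[unfolded density_1_iff_complement] this]
  have lim: "(\<lambda>k. 2 * (real (card ({..<2 ^ Suc k} - X)) / 2 ^ Suc k)) \<longlonglongrightarrow> 0"
    by (intro tendsto_mult_right_zero) (simp del: power_Suc)
  show ?thesis
  proof (rule tendsto_sandwich[OF _ _ tendsto_const lim])
    have "missing X k \<le> card ({..<2 ^ Suc k} - X)" for k
      unfolding missing_eq by (intro card_mono) auto
    then show "\<forall>\<^sub>F k in sequentially.
        real (missing X k) / 2 ^ k \<le> 2 * (real (card ({..<2 ^ Suc k} - X)) / 2 ^ Suc k)"
      by (intro always_eventually allI) (simp add: divide_right_mono)
  qed simp
qed

lemma missing_imp_density_1:
  assumes lim: "(\<lambda>k. real (missing X k) / 2 ^ k) \<longlonglongrightarrow> 0"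
  shows "density_1 X"
  unfolding density_1_iff_complement
proof (rule LIMSEQ_I)
  define f where "f n = real (card ({..<n} - X))" for n
  fix r :: real assume "0 < r"
  \<comment> \<open>The final estimate stays below \<open>3 * e * n\<close>: the blocks from
    \<open>K\<close> on give \<open>2 * e * n\<close>, and \<open>e * n\<close> absorbs the constant
    \<open>2 ^ K\<close>.\<close>
  define e where "e = r / 4"
  have e: "0 < e"
    using \<open>0 < r\<close> by (simp add: e_def)
  obtain K where K: "\<And>k. K \<le> k \<Longrightarrow> real (missing X k) / 2 ^ k < e"
    using LIMSEQ_D[OF lim e] by auto
  have step: "f (2 ^ Suc k) \<le> f (2 ^ k) + real (missing X k)" for k
  proof -
    have "{..<2 ^ Suc k} - X \<subseteq> ({..<2 ^ k} - X) \<union> ({2 ^ k..<2 ^ Suc k} - X)"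
      by auto
    then have "card ({..<2 ^ Suc k} - X) \<le> card (({..<2 ^ k} - X) \<union> ({2 ^ k..<2 ^ Suc k} - X))"
      by (intro card_mono) auto
    also have "\<dots> \<le> card ({..<2 ^ k} - X) + missing X k"
      unfolding missing_eq by (rule card_Un_le)
    finally show ?thesis
      unfolding f_def by linarith
  qed
  \<comment> \<open>The term \<open>e * 2 ^ k\<close> doubles in each step because block
    \<open>k\<close> adds at most the same amount again.\<close>
  have pow: "f (2 ^ k) \<le> 2 ^ K + e * 2 ^ k" if "K \<le> k" for k
    using that
  proof (induction k rule: dec_induct)
    case base
    have "card ({..<2 ^ K} - X) \<le> card {..<2 ^ K :: nat}"
      by (intro card_mono) auto
    from of_nat_mono[OF this, where 'a = real] have "f (2 ^ K) \<le> 2 ^ K"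
      unfolding f_def by simp
    then show ?case
      using e by (simp add: add_increasing2)
  next
    case (step k)
    have "real (missing X k) \<le> e * 2 ^ k"
      using K[OF step.hyps(1)] by (simp add: divide_simps mult.commute)
    then show ?case
      using step.IH \<open>f (2 ^ Suc k) \<le> f (2 ^ k) + real (missing X k)\<close> by simp
  qed
  have bound: "f n \<le> 2 ^ K + 2 * e * real n" if n: "2 ^ K \<le> n" for n
  proof -
    have "0 < n"
      using n by (cases "n = 0") simp_all
    \<comment> \<open>The length of the string numbered \<open>n\<close> yields the two powers of 2
      enclosing \<open>n\<close>.\<close>
    then obtain \<sigma> where \<sigma>: "num \<sigma> = n"
      using ex_num by blast
    define k where "k = length \<sigma>"
    have k: "2 ^ k \<le> n" "n < 2 ^ Suc k"
      using num_bounds[of \<sigma>] unfolding \<sigma> k_def by auto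
    have "(2::nat) ^ K < 2 ^ Suc k"
      using n k(2) by (rule le_less_trans)
    then have "K \<le> Suc k"
      using power_less_imp_less_exp[of "2::nat" K "Suc k"] by simp
    have "f n \<le> f (2 ^ Suc k)"
      unfolding f_def using k(2) by (intro of_nat_mono card_mono) (auto simp del: power_Suc)
    also have "\<dots> \<le> 2 ^ K + 2 * e * 2 ^ k"
      using pow[OF \<open>K \<le> Suc k\<close>] by simp
    also have "\<dots> \<le> 2 ^ K + 2 * e * real n"
    proof -
      have "(2::real) ^ k \<le> real n"
        using of_nat_mono[OF k(1), where 'a = real] by simp
      then show ?thesis using e by simp
    qed
    finally show ?thesis .
  qed
  obtain N where N: "2 ^ K / e < real N"
    using reals_Archimedean2 by blast
  show "\<exists>no. \<forall>n\<ge>no. norm (real (card ({..<n} - X)) / real n - 0) < r"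
  proof (intro exI allI impI)
    fix n assume n: "max (Suc N) (2 ^ K) \<le> n"
    then have pos: "0 < real n" and "real N < real n"
      by auto
    then have "2 ^ K / e < real n"
      using N by linarith
    then have "2 ^ K < e * real n"
      using e by (simp add: divide_simps mult.commute)
    moreover have "f n \<le> 2 ^ K + 2 * (e * real n)"
      using bound[of n] n by simp
    moreover have "0 < e * real n" "r * real n = 4 * (e * real n)"
      using e pos by (simp_all add: e_def)
    ultimately have "f n < r * real n"
      by linarith
    then show "norm (real (card ({..<n} - X)) / real n - 0) < r"
      using pos by (simp add: f_def divide_simps)
  qed
qed

lemma density_1_Int:
  assumes "density_1 X" "density_1 Y"
  shows "density_1 (X \<inter> Y)"
proof (rule missing_imp_density_1)
  have lim: "(\<lambda>k. real (missing X k) / 2 ^ k + real (missing Y k) / 2 ^ k) \<longlonglongrightarrow> 0"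
    using tendsto_add[OF density_1_imp_missing[OF assms(1)] density_1_imp_missing[OF assms(2)]]
    by simp
  have "missing (X \<inter> Y) k \<le> missing X k + missing Y k" for k
  proof -
    have "{\<sigma>. length \<sigma> = k \<and> num \<sigma> \<notin> X \<inter> Y} =
        {\<sigma>. length \<sigma> = k \<and> num \<sigma> \<notin> X} \<union> {\<sigma>. length \<sigma> = k \<and> num \<sigma> \<notin> Y}"
      by auto
    then show ?thesis
      using card_Un_le by simp
  qed
  then have "real (missing (X \<inter> Y) k) \<le> real (missing X k) + real (missing Y k)" for k
    unfolding of_nat_add[symmetric] by (rule of_nat_mono)
  then show "(\<lambda>k. real (missing (X \<inter> Y) k) / 2 ^ k) \<longlonglongrightarrow> 0"
    by (intro tendsto_sandwich[OF _ _ tendsto_const lim] always_eventually allI)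
      (auto simp: add_divide_distrib[symmetric] divide_right_mono)
qed

text \<open>A finite set has density 0. Applied to the domain of a generic oracle, this supplies
  infinitely many known values of \<open>A\<close>.\<close>

lemma density_1_infinite:
  assumes "density_1 X"
  shows "infinite X"
proof
  assume "finite X"
  have "(\<lambda>n. real (card (X \<inter> {..<n})) / real n) \<longlonglongrightarrow> 0"
  proof (rule tendsto_sandwich[OF _ _ tendsto_const lim_const_over_n])
    have "real (card (X \<inter> {..<n})) \<le> real (card X)" for n
      using \<open>finite X\<close> by (intro of_nat_mono card_mono) auto
    then show "\<forall>\<^sub>F n in sequentially. real (card (X \<inter> {..<n})) / real n \<le> real (card X) / real n"
      by (intro always_eventually allI divide_right_mono) auto
  qed simp
  from LIMSEQ_unique[OF this assms[unfolded density_1_def]] show False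
    by simp
qed

text \<open>Such a string is determined by the set of positions outside \<open>F\<close> where its
  entry is \<open>True\<close>.\<close>

lemma card_strings_agreeing:
  assumes "F \<subseteq> {..<k}"
  shows "card {\<sigma>. length \<sigma> = k \<and> (\<forall>i\<in>F. \<sigma> ! i \<longleftrightarrow> i \<in> A)} \<le> 2 ^ (k - card F)" (is "card ?S \<le> _")
proof -
  have "inj_on (\<lambda>\<sigma>. {i \<in> {..<k} - F. \<sigma> ! i}) ?S"
  proof (rule inj_onI)
    fix \<sigma> \<tau> assume \<sigma>: "\<sigma> \<in> ?S" and \<tau>: "\<tau> \<in> ?S"
      and eq: "{i \<in> {..<k} - F. \<sigma> ! i} = {i \<in> {..<k} - F. \<tau> ! i}"
    show "\<sigma> = \<tau>"
    proof (rule nth_equalityI)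
      fix i assume "i < length \<sigma>"
      then show "\<sigma> ! i = \<tau> ! i"
        using \<sigma> \<tau> eq by (cases "i \<in> F") (auto simp: set_eq_iff)
    qed (use \<sigma> \<tau> in auto)
  qed
  then have "card ?S \<le> card (Pow ({..<k} - F))"
    by (rule card_inj_on_le) auto
  also have "\<dots> = 2 ^ (k - card F)"
    using assms finite_subset[OF assms] by (simp add: card_Pow card_Diff_subset)
  finally show ?thesis .
qed

text \<open>For any fixed finite \<open>F\<close> inside \<open>D\<close>, a long string missing
  from this set agrees with \<open>A\<close> on \<open>F\<close>, which leaves a fraction of at most
  \<open>(1 / 2) ^ card F\<close>.\<close>

lemma density_1_disagreeing:
  assumes D: "infinite D"
  shows "density_1 {num \<sigma> |\<sigma>. \<exists>i<length \<sigma>. i \<in> D \<and> \<sigma> ! i \<noteq> (i \<in> A)}" (is "density_1 ?X")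
proof (intro missing_imp_density_1 LIMSEQ_I)
  fix r :: real assume "0 < r"
  then obtain n where n: "(1 / 2) ^ n < r"
    using real_arch_pow_inv[of r "1 / 2"] by auto
  obtain F where F: "F \<subseteq> D" "finite F" "card F = n"
    using infinite_arbitrarily_large[OF D] by blast
  obtain N where N: "F \<subseteq> {..<N}"
    using \<open>finite F\<close> by (metis finite_nat_iff_bounded)
  show "\<exists>N. \<forall>k\<ge>N. norm (real (missing ?X k) / 2 ^ k - 0) < r"
  proof (intro exI allI impI)
    fix k assume "N \<le> k"
    then have Fk: "F \<subseteq> {..<k}"
      using N by auto
    then have "n \<le> k"
      using F(3) card_mono[OF finite_lessThan Fk] by simp
    have "missing ?X k \<le> card {\<sigma>. length \<sigma> = k \<and> (\<forall>i\<in>F. \<sigma> ! i \<longleftrightarrow> i \<in> A)}"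
      using F(1) Fk by (intro card_mono) auto
    also have "\<dots> \<le> 2 ^ (k - n)"
      using card_strings_agreeing[OF Fk] F(3) by simp
    finally have "missing ?X k \<le> 2 ^ (k - n)" .
    from of_nat_mono[OF this, where 'a = real] have "real (missing ?X k) \<le> 2 ^ (k - n)"
      by simp
    then have "real (missing ?X k) / 2 ^ k \<le> 2 ^ (k - n) / 2 ^ k"
      by (intro divide_right_mono) auto
    also have "\<dots> = (1 / 2) ^ n"
      using \<open>n \<le> k\<close> by (simp add: power_diff power_one_over)
    finally show "norm (real (missing ?X k) / 2 ^ k - 0) < r"
      using n by simp
  qed
qed

section \<open>Null classes\<close>

lemma cylinder:
  "{x. initial_segment \<sigma> (Collect x)} \<in> sets cantor_measure" (is ?th1)
  "measure cantor_measure {x. initial_segment \<sigma> (Collect x)} = (1 / 2) ^ length \<sigma>" (is ?th2)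
proof -
  let ?M = "\<lambda>_ :: nat. measure_pmf (bernoulli_pmf (1 / 2))"
  interpret product_prob_space ?M UNIV ..
  let ?C = "prod_emb UNIV ?M {..<length \<sigma>} (Pi\<^sub>E {..<length \<sigma>} (\<lambda>i. {\<sigma> ! i}))"
  have eq: "{x. initial_segment \<sigma> (Collect x)} = ?C"
    by (auto simp: prod_emb_def initial_segment_def space_PiM PiE_iff restrict_def)
  show ?th1
    unfolding eq cantor_measure_def by (intro sets_PiM_I) auto
  have "measure (PiM UNIV ?M) ?C = (\<Prod>i<length \<sigma>. measure (?M i) {\<sigma> ! i})"
    by (intro measure_PiM_emb) auto
  also have "\<dots> = (\<Prod>i<length \<sigma>. 1 / 2)"
  proof (rule prod.cong)
    show "measure (?M i) {\<sigma> ! i} = 1 / 2" for i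
      by (cases "\<sigma> ! i") (simp_all add: measure_pmf_single)
  qed simp
  finally show ?th2
    unfolding eq cantor_measure_def by simp
qed

text \<open>For each \<open>k\<close>, a member of the class has its initial segment of length
  \<open>k\<close> outside \<open>W\<close>. Hence the counted strings give a cover by cylinders of
  measure \<open>1 / 2 ^ k\<close> each.\<close>

lemma measure_zero_avoiding:
  assumes lim: "(\<lambda>k. real (card {\<sigma>. length \<sigma> = k \<and> \<sigma> \<notin> W}) / 2 ^ k) \<longlonglongrightarrow> 0"
  shows "measure_zero {X. \<not> (\<exists>\<sigma>\<in>W. initial_segment \<sigma> X)}"
proof -
  interpret prob_space cantor_measure
    unfolding cantor_measure_def by (intro prob_space_PiM prob_space_measure_pmf)
  have space: "space cantor_measure = UNIV"
    by (simp add: cantor_measure_def space_PiM)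
  let ?cyl = "\<lambda>\<sigma>. {x. initial_segment \<sigma> (Collect x)}"
  let ?N = "{x. Collect x \<in> {X. \<not> (\<exists>\<sigma>\<in>W. initial_segment \<sigma> X)}}"
  have "?N = space cantor_measure - (\<Union>\<sigma>\<in>W. ?cyl \<sigma>)"
    unfolding space by auto
  then have N: "?N \<in> sets cantor_measure"
    using cylinder(1) by (metis (no_types, lifting) countableI_type sets.compl_sets
        sets.countable_UN'' )
  have "prob ?N \<le> real (card {\<sigma>. length \<sigma> = k \<and> \<sigma> \<notin> W}) / 2 ^ k" for k
  proof -
    let ?S = "{\<sigma>. length \<sigma> = k \<and> \<sigma> \<notin> W}"
    have "?N \<subseteq> (\<Union>\<sigma>\<in>?S. ?cyl \<sigma>)"
    proof
      fix x assume x: "x \<in> ?N"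
      have "initial_segment (map x [0..<k]) (Collect x)"
        by (simp add: initial_segment_def)
      with x show "x \<in> (\<Union>\<sigma>\<in>?S. ?cyl \<sigma>)"
        by (intro UN_I[of "map x [0..<k]"]) auto
    qed
    then have "prob ?N \<le> prob (\<Union>\<sigma>\<in>?S. ?cyl \<sigma>)"
      using cylinder(1) by (intro finite_measure_mono) auto
    also have "\<dots> \<le> (\<Sum>\<sigma>\<in>?S. prob (?cyl \<sigma>))"
      using cylinder(1) by (intro finite_measure_subadditive_finite) auto
    also have "\<dots> = (\<Sum>\<sigma>\<in>?S. 1 / 2 ^ k)"
      by (intro sum.cong) (auto simp: cylinder(2) power_one_over)
    finally show ?thesis
      by simp
  qed
  then have "prob ?N \<le> 0"
    by (intro LIMSEQ_le_const[OF lim]) auto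
  then have "prob ?N = 0"
    using measure_nonneg by (rule antisym)
  then show ?thesis
    unfolding measure_zero_def using N by (simp add: null_sets_def emeasure_eq_measure)
qed

section \<open>Programs\<close>

text \<open>When \<open>p\<close> always converges, the least zero has only positive values before
  it.\<close>

lemma run_Mu_total:
  assumes "\<And>y. run Z p (y # xs) = Some (f y)"
  shows "run Z (Mu p) xs = (if \<exists>y. f y = 0 then Some (LEAST y. f y = 0) else None)"
proof -
  have "(\<exists>y. f y = 0 \<and> (\<forall>i<y. \<exists>v. f i = Suc v)) \<longleftrightarrow> (\<exists>y. f y = 0)"
    using exists_least_iff[of "\<lambda>y. f y = 0"] by (auto simp: not0_implies_Suc)
  then show ?thesis
    by (simp only: run.simps assms option.inject)
qed

text \<open>In the step program of a \<open>PrimRec\<close>, \<open>Proj 0\<close> is the counter,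
  \<open>Proj 1\<close> the value reached so far, and parameters start at
  \<open>Proj 2\<close>.\<close>

definition "add_prog = PrimRec (Proj 0) (Comp Succ [Proj 1])"

lemma run_add [simp]: "run Z add_prog [m, n] = Some (m + n)"
  unfolding add_prog_def by (induction m) auto

definition "pred_prog = PrimRec Zero (Proj 0)"

lemma run_pred [simp]: "run Z pred_prog [n] = Some (n - 1)"
  unfolding pred_prog_def by (induction n) auto

text \<open>The recursion variable comes first and counts the decrements, so the subtrahend precedes
  the minuend.\<close>

definition "rev_minus_prog = PrimRec (Proj 0) (Comp pred_prog [Proj 1])"

lemma run_rev_minus [simp]: "run Z rev_minus_prog [n, m] = Some (m - n)"
  unfolding rev_minus_prog_def by (induction n) auto

definition "is_zero_prog = PrimRec (Comp Succ [Zero]) Zero"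

lemma run_is_zero [simp]: "run Z is_zero_prog [n] = Some (of_bool (n = 0))"
  unfolding is_zero_prog_def by (induction n) auto

definition "parity_prog = PrimRec Zero (Comp is_zero_prog [Proj 1])"

lemma run_parity [simp]: "run Z parity_prog [n] = Some (n mod 2)"
  unfolding parity_prog_def by (induction n) (auto simp: mod_Suc)

definition "half_prog = PrimRec Zero (Comp add_prog [Proj 1, Comp parity_prog [Proj 0]])"

lemma run_half [simp]: "run Z half_prog [n] = Some (n div 2)"
  unfolding half_prog_def by (induction n) (auto, presburger)

definition "shift_prog = PrimRec (Proj 0) (Comp half_prog [Proj 1])"

lemma run_shift [simp]: "run Z shift_prog [i, m] = Some (m div 2 ^ i)"
  unfolding shift_prog_def by (induction i) (auto simp: div_mult2_eq[symmetric] mult.commute)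

text \<open>Composition is strict, so both branches get evaluated; those supplied below converge on
  the inputs considered.\<close>

definition "cond_prog = PrimRec (Proj 1) (Proj 2)"

lemma run_cond [simp]: "run Z cond_prog [b, x, y] = Some (if b = 0 then y else x)"
  unfolding cond_prog_def by (induction b) auto

definition "triangle_prog = PrimRec Zero (Comp add_prog [Proj 1, Comp Succ [Proj 0]])"

lemma run_triangle [simp]: "run Z triangle_prog [n] = Some (triangle n)"
  unfolding triangle_prog_def by (induction n) auto

text \<open>Cantor's pairing \<open>triangle (m + n) + m\<close>; the inner \<open>add_prog\<close>
  receives the whole argument list.\<close>

definition "pair_prog = Comp add_prog [Comp triangle_prog [add_prog], Proj 0]"

lemma run_pair [simp]: "run Z pair_prog [m, n] = Some (prod_encode (m, n))"
  unfolding pair_prog_def by (simp add: prod_encode_def)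

text \<open>Here \<open>n\<close> is the number of parameters. The projections hand them to
  \<open>p\<close> and skip the partial sum at position 1.\<close>

definition
  "sum_prog p n = PrimRec Zero (Comp add_prog [Proj 1, Comp p (Proj 0 # map (\<lambda>i. Proj (i + 2)) [0..<n])])"

lemma run_sum:
  assumes "\<And>i. run Z p (i # xs) = Some (f i)" "length xs = n"
  shows "run Z (sum_prog p n) (k # xs) = Some (\<Sum>i<k. f i)"
proof -
  have "map (the \<circ> (\<lambda>q. run Z q (i # v # xs)) \<circ> (\<lambda>i. Proj (i + 2))) [0..<n] = xs" for i v
    using assms(2) by (intro nth_equalityI) auto
  then have "run Z (Comp p (Proj 0 # map (\<lambda>i. Proj (i + 2)) [0..<n])) (i # v # xs) = Some (f i)" for i v
    using assms by (auto simp: comp_def)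
  then show ?thesis
    unfolding sum_prog_def by (induction k) (auto simp del: run.simps(5) simp: run.simps(5)[of _ add_prog])
qed

section \<open>Recovering a string from its code\<close>

lemma string_code_eq_iff: "string_code \<sigma> = string_code \<tau> \<longleftrightarrow> \<sigma> = \<tau>"
proof -
  have "inj (of_bool :: bool \<Rightarrow> nat)"
    by (rule injI) (simp add: of_bool_def split: if_splits)
  then show ?thesis
    unfolding string_code_def by (simp add: list_encode_eq inj_map_eq_map)
qed

text \<open>
  On input \<open>[j, num \<sigma>]\<close> this computes the code of the suffix of \<open>\<sigma>\<close> from position \<open>num \<sigma> - j\<close> on;
  as \<open>num \<sigma>\<close> exceeds the length of \<open>\<sigma>\<close>, the recursion on \<open>j\<close> starts with the empty suffix.
\<close>

definition
  "suffix_code_prog = PrimRec Zero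
     (let i = Comp rev_minus_prog [Comp Succ [Proj 0], Proj 2]
      in Comp cond_prog
          [Comp shift_prog [Comp Succ [i], Proj 2],
           Comp Succ [Comp pair_prog [Comp parity_prog [Comp shift_prog [i, Proj 2]], Proj 1]],
           Proj 1])"

lemma run_suffix_code:
  "j \<le> num \<sigma> \<Longrightarrow>
    run Z suffix_code_prog [j, num \<sigma>] = Some (string_code (drop (num \<sigma> - j) \<sigma>))"
proof (induction j)
  case 0
  then show ?case
    using length_less_num[of \<sigma>] by (simp add: suffix_code_prog_def string_code_def)
next
  case (Suc j)
  define i where "i = num \<sigma> - Suc j"
  have j: "num \<sigma> - j = Suc i"
    using Suc.prems by (simp add: i_def)
  let ?r = "string_code (drop (Suc i) \<sigma>)"
  have "run Z suffix_code_prog [Suc j, num \<sigma>] =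
      Some (if num \<sigma> div 2 ^ Suc i = 0 then ?r
            else Suc (prod_encode (num \<sigma> div 2 ^ i mod 2, ?r)))"
    using Suc.IH Suc.prems j unfolding suffix_code_prog_def i_def[symmetric]
    by (simp add: i_def[symmetric] Let_def del: power_Suc)
  \<comment> \<open>The zero quotient marks positions past the end, where the code of the empty
    suffix is kept; \<open>Suc\<close> of a pair is \<open>list_encode\<close> of a nonempty
    list.\<close>
  also have "\<dots> = Some (string_code (drop i \<sigma>))"
  proof (cases "i < length \<sigma>")
    case True
    then have "num \<sigma> div 2 ^ Suc i \<noteq> 0"
      using num_div_pow[of "Suc i" \<sigma>] by (simp del: power_Suc)
    moreover have "num \<sigma> div 2 ^ i mod 2 = of_bool (\<sigma> ! i)"
      using odd_num_div_pow[OF True] by (simp add: mod_2_eq_odd)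
    moreover have "drop i \<sigma> = \<sigma> ! i # drop (Suc i) \<sigma>"
      using True by (simp add: Cons_nth_drop_Suc)
    ultimately show ?thesis
      by (simp add: string_code_def)
  next
    case False
    then show ?thesis
      by (simp add: num_div_pow_eq_0 del: power_Suc)
  qed
  finally show ?case
    unfolding i_def .
qed

text \<open>Inverts the code by search: \<open>y\<close> stands for the number \<open>Suc y\<close>,
  since no string has number 0, and the sum of the two truncated differences vanishes exactly when
  the codes agree.\<close>

definition
  "num_prog = Comp Succ
     [Mu (let c = Comp suffix_code_prog [Comp Succ [Proj 0], Comp Succ [Proj 0]]
          in Comp add_prog
              [Comp rev_minus_prog [c, Proj 1], Comp rev_minus_prog [Proj 1, c]])]"

lemma run_num: "run Z num_prog [string_code \<sigma>] = Some (num \<sigma>)"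
proof -
  define unnum where "unnum y = inv num (Suc y)" for y
  have unnum: "num (unnum y) = Suc y" for y
    unfolding unnum_def using ex_num[of "Suc y"] by (metis f_inv_into_f rangeI zero_less_Suc)
  define f where
    "f y = (string_code \<sigma> - string_code (unnum y)) + (string_code (unnum y) - string_code \<sigma>)" for y
  have "f y = 0 \<longleftrightarrow> string_code (unnum y) = string_code \<sigma>" for y
    unfolding f_def by auto
  then have f0: "f y = 0 \<longleftrightarrow> Suc y = num \<sigma>" for y
    by (simp add: string_code_eq_iff unnum[symmetric])
  then have *: "f (num \<sigma> - 1) = 0"
    by simp
  have L: "(LEAST y. f y = 0) = num \<sigma> - 1"
    using f0 * by (intro Least_equality) auto
  have "run Z suffix_code_prog [Suc y, Suc y] = Some (string_code (unnum y))" for y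
    using run_suffix_code[of "Suc y" "unnum y" Z] by (simp add: unnum)
  then have test: "run Z (let c = Comp suffix_code_prog [Comp Succ [Proj 0], Comp Succ [Proj 0]]
      in Comp add_prog [Comp rev_minus_prog [c, Proj 1], Comp rev_minus_prog [Proj 1, c]])
      [y, string_code \<sigma>] = Some (f y)" for y
    by (simp add: f_def Let_def)
  show ?thesis
    unfolding num_prog_def using run_Mu_total[of Z, OF test] * L by auto
qed

text \<open>The outer \<open>Mu\<close> diverges exactly on the value 0.\<close>

definition "enum_prog p = Comp (Mu (Comp is_zero_prog [Proj 1])) [Comp p [num_prog]]"

text \<open>Bridges the two numberings: \<open>ce_strings\<close> refers to
  \<open>string_code\<close>, whereas generic computations here run on
  \<open>num \<sigma>\<close>.\<close>

lemma run_enum: "run Z (enum_prog p) [string_code \<sigma>] \<noteq> None \<longleftrightarrow> (\<exists>v. run Z p [num \<sigma>] = Some (Suc v))"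
proof -
  have mu: "run Z (Mu (Comp is_zero_prog [Proj 1])) [v] \<noteq> None \<longleftrightarrow> v \<noteq> 0" for v
    by (auto simp: Suc_le_eq)
  show ?thesis
  proof (cases "run Z p [num \<sigma>]")
    case None
    then show ?thesis
      by (simp add: enum_prog_def run_num del: run.simps(7))
  next
    case (Some v)
    then have "run Z (enum_prog p) [string_code \<sigma>] = run Z (Mu (Comp is_zero_prog [Proj 1])) [v]"
      by (simp add: enum_prog_def run_num del: run.simps(7))
    then show ?thesis
      using mu Some by (simp add: not0_implies_Suc gr0_conv_Suc del: run.simps(7))
  qed
qed

section \<open>The reduction\<close>

text \<open>Testing the parity for zero flips entry \<open>i\<close>, so the oracle is asked for the
  value opposite to that of the string. Past the end of the string the answer is discarded.\<close>

definition
  "query_prog =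
     (let l = Proj 0; i = Proj 1; m = Proj 2
      in Comp cond_prog
          [Comp shift_prog [Comp Succ [i], m],
           Comp Query [Comp pair_prog
             [i, Comp pair_prog [Comp is_zero_prog [Comp parity_prog [Comp shift_prog [i, m]]], l]]],
           Zero])"

text \<open>For \<open>m = num \<sigma>\<close> the first conjunct says that \<open>i < length \<sigma>\<close>.\<close>

abbreviation disagreement :: "nat set \<Rightarrow> nat \<Rightarrow> nat \<Rightarrow> nat \<Rightarrow> bool" where
  "disagreement Z m i l \<equiv> m div 2 ^ Suc i \<noteq> 0 \<and> triple_code (i, even (m div 2 ^ i), l) \<in> Z"

lemma run_query: "run Z query_prog [l, i, m] = Some (of_bool (disagreement Z m i l))"
  unfolding query_prog_def
  by (simp add: triple_code_def even_iff_mod_2_eq_zero Let_def del: power_Suc)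

text \<open>The variable of \<open>Mu\<close> bounds both \<open>i\<close> and \<open>l\<close>, and
  the double sum counts the disagreements in that square. The inner sum wants its bound first, hence
  the swapped projections. Only the answer 1 is ever given.\<close>

definition
  "search_prog = Comp (Comp Succ [Zero])
     [Mu (Comp is_zero_prog
       [Comp (sum_prog (Comp (sum_prog query_prog 2) [Proj 1, Proj 0, Proj 2]) 2)
         [Proj 0, Proj 0, Proj 1]])]"

lemma run_search:
  "run Z search_prog [m] = (if \<exists>i l. disagreement Z m i l then Some 1 else None)"
proof -
  define g where "g y = (\<Sum>i<y. \<Sum>l<y. of_bool (disagreement Z m i l) :: nat)" for y
  define f :: "nat \<Rightarrow> nat" where "f y = of_bool (g y = 0)" for y
  have inner: "run Z (sum_prog query_prog 2) [y, i, m] =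
      Some (\<Sum>l<y. of_bool (disagreement Z m i l))" for y i
    by (intro run_sum run_query) simp
  have "run Z (Comp (sum_prog query_prog 2) [Proj 1, Proj 0, Proj 2]) [i, y, m] =
      Some (\<Sum>l<y. of_bool (disagreement Z m i l))" for y i
    using inner by simp
  then have "run Z (sum_prog (Comp (sum_prog query_prog 2) [Proj 1, Proj 0, Proj 2]) 2) [y, y, m] =
      Some (g y)" for y
    unfolding g_def by (intro run_sum) simp_all
  then have f: "run Z (Comp is_zero_prog
       [Comp (sum_prog (Comp (sum_prog query_prog 2) [Proj 1, Proj 0, Proj 2]) 2)
         [Proj 0, Proj 0, Proj 1]]) [y, m] = Some (f y)" for y
    by (simp add: f_def)
  have "f y = 0 \<longleftrightarrow> (\<exists>i<y. \<exists>l<y. disagreement Z m i l)" for y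
    unfolding f_def g_def by auto
  moreover have "(\<exists>y. \<exists>i<y. \<exists>l<y. disagreement Z m i l) \<longleftrightarrow> (\<exists>i l. disagreement Z m i l)"
  proof
    assume "\<exists>i l. disagreement Z m i l"
    then obtain i l where "disagreement Z m i l"
      by blast
    moreover have "i < Suc (max i l)" "l < Suc (max i l)"
      by auto
    ultimately show "\<exists>y. \<exists>i<y. \<exists>l<y. disagreement Z m i l"
      by blast
  qed blast
  ultimately have "(\<exists>y. f y = 0) \<longleftrightarrow> (\<exists>i l. disagreement Z m i l)"
    by simp
  then show ?thesis
    unfolding search_prog_def using run_Mu_total[OF f] by simp
qed

lemma inj_triple_code: "inj triple_code"
  by (rule injI) (auto simp: triple_code_def of_bool_def split: if_splits)

lemma disagreement_num:
  "disagreement (triple_code ` P) (num \<sigma>) i l \<longleftrightarrow> i < length \<sigma> \<and> (i, \<not> \<sigma> ! i, l) \<in> P"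
proof (cases "i < length \<sigma>")
  case True
  then have "num \<sigma> div 2 ^ Suc i \<noteq> 0"
    using num_div_pow[of "Suc i" \<sigma>] by (simp del: power_Suc)
  moreover have "even (num \<sigma> div 2 ^ i) \<longleftrightarrow> \<not> \<sigma> ! i"
    using odd_num_div_pow[OF True] by blast
  ultimately show ?thesis
    using True by (simp add: inj_image_mem_iff[OF inj_triple_code] del: power_Suc)
next
  case False
  then show ?thesis
    by (simp add: num_div_pow_eq_0 del: power_Suc)
qed

section \<open>The witness for density-1-bounding\<close>

definition avoiding :: "nat set \<Rightarrow> nat set" where
  "avoiding A = {num \<sigma> |\<sigma>. \<not> initial_segment \<sigma> A}"

lemma num_in_avoiding: "num \<sigma> \<in> avoiding A \<longleftrightarrow> \<not> initial_segment \<sigma> A"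
  by (auto simp: avoiding_def)

lemma generic_computation_search:
  assumes "generic_oracle A P"
  shows "generic_computation (triple_code ` P) search_prog (avoiding A)"
proof -
  have P: "\<And>n x l. (n, x, l) \<in> P \<Longrightarrow> (n \<in> A) = x" and D: "density_1 (oracle_domain P)"
    using assms by (auto simp: generic_oracle_def partial_oracle_def)
  let ?run = "run (triple_code ` P) search_prog"
  let ?D = "{num \<sigma> |\<sigma>. \<exists>i<length \<sigma>. i \<in> oracle_domain P \<and> \<sigma> ! i \<noteq> (i \<in> A)}"
  have dom: "?run [n] \<noteq> None \<longleftrightarrow> n \<in> ?D" for n
  \<comment> \<open>All quotients of 0 vanish, so the search diverges on the one number that codes
    no string.\<close>
  proof (cases "n = 0")
    case True
    then show ?thesis
      by (auto simp: run_search)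
  next
    case False
    then obtain \<sigma> where [simp]: "n = num \<sigma>"
      using ex_num by (metis not_gr_zero)
    have "?run [n] \<noteq> None \<longleftrightarrow> (\<exists>i l. i < length \<sigma> \<and> (i, \<not> \<sigma> ! i, l) \<in> P)"
      unfolding run_search \<open>n = num \<sigma>\<close> disagreement_num by simp
    also have "\<dots> \<longleftrightarrow> n \<in> ?D"
    proof -
      \<comment> \<open>Listed values are those of \<open>A\<close>, so the opposite of
        \<open>\<sigma> ! i\<close> is listed exactly when \<open>i\<close> is in the domain and
        \<open>\<sigma>\<close> is wrong there.\<close>
      have "(\<exists>l. (i, \<not> \<sigma> ! i, l) \<in> P) \<longleftrightarrow> i \<in> oracle_domain P \<and> \<sigma> ! i \<noteq> (i \<in> A)" for i
        using P[of i True] P[of i False]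
        by (cases "\<sigma> ! i"; cases "i \<in> A") (auto simp: oracle_domain_def ex_bool_eq)
      then show ?thesis
        by auto
    qed
    finally show ?thesis .
  qed
  have "density_1 ?D"
    using density_1_disagreeing density_1_infinite[OF D] .
  then have "density_1 {n. ?run [n] \<noteq> None}"
    by (simp only: dom Collect_mem_eq)
  moreover have "v = of_bool (n \<in> avoiding A)" if "?run [n] = Some v" for n v
  proof -
    have "n \<in> avoiding A"
      using dom[of n] that by (auto simp: avoiding_def initial_segment_def)
    moreover have "v = 1"
      using that by (simp add: run_search split: if_splits)
    ultimately show ?thesis by simp
  qed
  ultimately show ?thesis
    unfolding generic_computation_def by blast
qed

text \<open>The counting argument for disagreement, with every position taken as known.\<close>

lemma density_1_avoiding: "density_1 (avoiding A)"
proof -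
  have "density_1 {num \<sigma> |\<sigma>. \<exists>i<length \<sigma>. i \<in> UNIV \<and> \<sigma> ! i \<noteq> (i \<in> A)}"
    by (rule density_1_disagreeing) simp
  then show ?thesis
    by (simp add: avoiding_def initial_segment_def)
qed

lemma avoiding_not_generically_computable:
  assumes "weakly_1_random A"
  shows "\<not> generically_computable (avoiding A)"
proof
  assume "generically_computable (avoiding A)"
  then obtain p where dens: "density_1 {n. run0 p [n] \<noteq> None}"
    and val: "\<And>n v. run0 p [n] = Some v \<Longrightarrow> v = of_bool (n \<in> avoiding A)"
    unfolding generically_computable_def generic_computation_def by blast
  \<comment> \<open>A positive value asserts membership in \<open>avoiding A\<close>; convergence to
    0 asserts the opposite and must not put a string into \<open>W\<close>.\<close>
  define W where "W = {\<sigma>. \<exists>v. run0 p [num \<sigma>] = Some (Suc v)}"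
  let ?C = "{X. \<not> (\<exists>\<sigma>\<in>W. initial_segment \<sigma> X)}"
  have "ce_strings W"
    unfolding ce_strings_def W_def using run_enum[of "{}" p] by blast
  then have "Pi01_class ?C"
    unfolding Pi01_class_def by blast
  moreover have "measure_zero ?C"
  proof (rule measure_zero_avoiding)
    have W: "\<sigma> \<in> W \<longleftrightarrow> num \<sigma> \<in> {n. run0 p [n] \<noteq> None} \<inter> avoiding A" for \<sigma>
      using val[of "num \<sigma>"] by (auto simp: W_def of_bool_def split: if_splits)
    show "(\<lambda>k. real (card {\<sigma>. length \<sigma> = k \<and> \<sigma> \<notin> W}) / 2 ^ k) \<longlonglongrightarrow> 0"
      unfolding W by (intro density_1_imp_missing density_1_Int dens density_1_avoiding)
  qed
  \<comment> \<open>Correctness of \<open>p\<close> keeps the initial segments of \<open>A\<close>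
    out of \<open>W\<close>.\<close>
  moreover have "A \<in> ?C"
    using val by (fastforce simp: W_def num_in_avoiding split: if_splits)
  ultimately show False
    using assms unfolding weakly_1_random_def by blast
qed

theorem proposition5p1:
  fixes A :: "nat set"
  assumes "weakly_1_random A"
  shows "density_1_bounding A"
  unfolding density_1_bounding_def generically_reducible_def
  using density_1_avoiding avoiding_not_generically_computable[OF assms]
    generic_computation_search by blast

end
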